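(* Let $a_1, a_2,a_3>0$ be constants with $a_2=a_3\equiv a>0$ and consider the system $$\begin{cases} u_1' = u_1^2(a_2u_2+a_3u_3-a_1u_1),\\ u_2' = u_2^2(a_3u_3+a_1u_1-a_2u_2),\\ u_3' = u_3^2(a_1u_1+a_2u_2-a_3u_3), \end{cases}\qquad {}'=\frac{d}{dt},$$ with sufficiently large initial data $u_1(0)>0$ and $u_2(0)=u_3(0)>0$. Then the solution blows up at a time $t=t_{\max}<\infty$ with the following asymptotic behavior. 1. If $2a>a_1>a_2=a_3\equiv a>0$, then $u_1(t),u_2(t),u_3(t)\sim C(t_{\max}-t)^{-1/2}$ as $t\to t_{\max}$. 2. If $a_1>2a>a_2=a_3\equiv a>0$, then $u_1(t)\sim C(t_{\max}-t)^{\frac{-2a}{2a+a_1}}$ and $u_2(t)=u_3(t)\sim C(t_{\max}-t)^{\frac{-a_1}{2a+a_1}}$ as $t\to t_{\max}$. 3. If $2a=a_1>a_2=a_3\equiv a>0$, then $u_1(t)\sim C\left\{(t_{\max}-t)^{-1}\left(\log(t_{\max}-t)^{-1}\right)^{-1}\right\}^{1/2}$ and $u_2(t)=u_3(t)\sim C\left\{(t_{\max}-t)^{-1}\log(t_{\max}-t)^{-1}\right\}^{1/2}$ as $t\to t_{\max}$.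
   Context: Here $f\sim g$ as $t\to t_{\max}$ means $\lim_{t\to t_{\max}-0}|f(t)/g(t)|=1$. The symbol $C$ denotes a generic positive constant: each asymptotic relation holds for some constant $C>0$, and the constants in different relations (including those for different components) may differ. $t_{\max}$ denotes the maximal existence time of the solution. *)

theory Defs
  imports "HOL-Analysis.Analysis"
begin

definition existence_interval :: "ereal \<Rightarrow> real set" where
  "existence_interval T = {t. 0 \<le> t \<and> ereal t < T}"

definition solves_system ::
  "real \<Rightarrow> real \<Rightarrow> real \<Rightarrow> (real \<Rightarrow> real) \<Rightarrow> (real \<Rightarrow> real) \<Rightarrow> (real \<Rightarrow> real) \<Rightarrow> ereal \<Rightarrow> bool" where
  "solves_system a1 a2 a3 u1 u2 u3 T \<longleftrightarrow> 0 < T \<and>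
     (\<forall>t\<in>existence_interval T.
        (u1 has_real_derivative (u1 t)\<^sup>2 * (a2 * u2 t + a3 * u3 t - a1 * u1 t))
          (at t within existence_interval T) \<and>
        (u2 has_real_derivative (u2 t)\<^sup>2 * (a3 * u3 t + a1 * u1 t - a2 * u2 t))
          (at t within existence_interval T) \<and>
        (u3 has_real_derivative (u3 t)\<^sup>2 * (a1 * u1 t + a2 * u2 t - a3 * u3 t))
          (at t within existence_interval T))"

text \<open>A solution on \<open>[0, T)\<close> is maximal if no solution on a longer interval extends it; \<open>T\<close> is then
  the maximal existence time, possibly infinite. Values of the functions outside \<open>[0, T)\<close> are
  irrelevant.\<close>

definition maximal_solution ::
  "real \<Rightarrow> real \<Rightarrow> real \<Rightarrow> (real \<Rightarrow> real) \<Rightarrow> (real \<Rightarrow> real) \<Rightarrow> (real \<Rightarrow> real) \<Rightarrow> ereal \<Rightarrow> bool" where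
  "maximal_solution a1 a2 a3 u1 u2 u3 T \<longleftrightarrow> solves_system a1 a2 a3 u1 u2 u3 T \<and>
     \<not> (\<exists>T' v1 v2 v3. T < T' \<and> solves_system a1 a2 a3 v1 v2 v3 T' \<and>
          (\<forall>t\<in>existence_interval T. v1 t = u1 t \<and> v2 t = u2 t \<and> v3 t = u3 t))"

definition blows_up_at ::
  "(real \<Rightarrow> real) \<Rightarrow> (real \<Rightarrow> real) \<Rightarrow> (real \<Rightarrow> real) \<Rightarrow> real \<Rightarrow> bool" where
  "blows_up_at u1 u2 u3 tmax \<longleftrightarrow>
     filterlim (\<lambda>t. norm (u1 t, u2 t, u3 t)) at_top (at_left tmax)"

text \<open>\<open>f \<sim> g\<close> as \<open>t\<close> tends to \<open>tmax\<close> from the left, with the absolute value of the quotient; this is not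
  the library's \<open>asymp_equiv\<close>.\<close>

definition asymp_left :: "real \<Rightarrow> (real \<Rightarrow> real) \<Rightarrow> (real \<Rightarrow> real) \<Rightarrow> bool" where
  "asymp_left tmax f g \<longleftrightarrow> ((\<lambda>t. \<bar>f t / g t\<bar>) \<longlongrightarrow> 1) (at_left tmax)"

text \<open>\<open>f \<sim> C g\<close> with a generic positive constant \<open>C\<close>.\<close>

definition asymp_left_const :: "real \<Rightarrow> (real \<Rightarrow> real) \<Rightarrow> (real \<Rightarrow> real) \<Rightarrow> bool" where
  "asymp_left_const tmax f g \<longleftrightarrow> (\<exists>C>0. asymp_left tmax f (\<lambda>t. C * g t))"

end

theory Submission imports Defs "HOL-Complex_Analysis.Conformal_Mappings" "HOL-Real_Asymp.Real_Asymp" begin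

text \<open>On the invariant set \<open>u2 = u3\<close> the system reduces to the plane. Write \<open>x = u1\<close> and \<open>y = u2 = u3\<close>; then
  \<open>y' = a1 x y\<^sup>2\<close>, so \<open>y\<close> increases and can serve as the new time. The ratio \<open>y / x\<close>, seen as a function
  \<open>Z\<close> of \<open>y\<close>, satisfies the linear equation \<open>y Z'(y) = 1 - \<beta> Z(y)\<close> with \<open>\<beta> = 2 a / a1 - 1\<close>. Hence
  \<open>Z(y) = 1 / \<beta> + c y\<^sup>-\<^sup>\<beta>\<close>, or \<open>Z(y) = ln y + c\<close> if \<open>\<beta> = 0\<close>. Physical time is recovered by a quadrature:
  the function \<open>F(y) = \<integral> Z(s) / (a1 s\<^sup>3) ds\<close> over \<open>s > y\<close> is the time that remains when the second
  component is \<open>y\<close>, because \<open>F(y(t)) + t\<close> is constant along solutions. The integral converges, as \<open>\<beta> > -1\<close>.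

  So the level curve \<open>F(y(t)) = F(q) - t\<close> contains everything (lemma \<open>solution_on_profile\<close>). No solution can live
  longer than \<open>F(q)\<close>; conversely, inverting \<open>F\<close> gives a solution on all of \<open>[0, F(q))\<close>
  (\<open>profile_solution\<close>), and every other solution with the same data is a restriction of it. Therefore the
  maximal existence time is \<open>F(q)\<close>, and \<open>y\<close> tends to infinity there.

  An asymptotic relation as \<open>t\<close> tends to \<open>tmax\<close> becomes a limit as \<open>y\<close> tends to infinity, with \<open>F(y)\<close> in place of
  \<open>tmax - t\<close> and \<open>y / Z(y)\<close> in place of \<open>u1\<close> (\<open>asymp_left_from_profile\<close>). The three regimes are the three
  behaviours of \<open>Z\<close> at infinity: for \<open>a1 < 2 a\<close> it tends to the constant \<open>1 / \<beta>\<close>, and all components grow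
  alike; for \<open>a1 > 2 a\<close> it grows like the power \<open>y\<^sup>-\<^sup>\<beta>\<close>; for \<open>a1 = 2 a\<close> it grows logarithmically, which
  produces the logarithmic corrections.\<close>

section \<open>Linear equations on the existence interval\<close>

lemma convex_existence_interval: "convex (existence_interval T)"
proof -
  have "is_interval (existence_interval T)"
    unfolding is_interval_1 existence_interval_def
    by (auto intro: order_le_less_trans[OF ereal_less_eq(3)[THEN iffD2]])
  then show ?thesis
    by (simp add: is_interval_convex)
qed

lemma Icc_subset_existence_interval:
  assumes "t \<in> existence_interval T"
  shows "{0..t} \<subseteq> existence_interval T"
  using assms by (auto simp: existence_interval_def
      intro: order_le_less_trans[OF ereal_less_eq(3)[THEN iffD2]])

lemma zero_derivative_existence_interval:
  assumes "\<And>t. t \<in> existence_interval T \<Longrightarrow>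
      (f has_real_derivative 0) (at t within existence_interval T)"
    and "0 < T" and "t \<in> existence_interval T"
  shows "f t = f 0"
proof -
  have "0 \<in> existence_interval T"
    using assms(2) by (simp add: existence_interval_def zero_ereal_def)
  moreover obtain c where "\<forall>x\<in>existence_interval T. f x = c"
    using has_field_derivative_zero_constant[OF convex_existence_interval assms(1)] by blast
  ultimately show ?thesis
    using assms(3) by auto
qed

text \<open>The factor is \<open>exp\<close> of an integral of \<open>h\<close>. Because it is positive, a solution that starts at zero
  stays zero, and one that starts positive stays positive.\<close>

lemma linear_ode_positive_multiple:
  fixes f h :: "real \<Rightarrow> real"
  assumes f: "\<And>t. t \<in> existence_interval T \<Longrightarrow>
      (f has_real_derivative h t * f t) (at t within existence_interval T)"
    and h: "continuous_on (existence_interval T) h"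
    and t: "t \<in> existence_interval T"
  shows "\<exists>k>0. f t = k * f 0"
proof -
  have t0: "0 \<le> t" and sub: "{0..t} \<subseteq> existence_interval T"
    using t Icc_subset_existence_interval[OF t] by (auto simp: existence_interval_def)
  obtain H where H: "\<And>x. x \<in> {0..t} \<Longrightarrow> (H has_vector_derivative h x) (at x within {0..t})"
    using antiderivative_continuous[OF continuous_on_subset[OF h sub]] by blast
  have "((\<lambda>x. f x * exp (- H x)) has_real_derivative 0) (at x within {0..t})"
    if x: "x \<in> {0..t}" for x
  proof -
    have 1: "(f has_real_derivative h x * f x) (at x within {0..t})"
      using f[of x] x sub by (meson has_field_derivative_subset subsetD)
    have 2: "(H has_real_derivative h x) (at x within {0..t})"
      using H[OF x] by (simp add: has_real_derivative_iff_has_vector_derivative)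
    show ?thesis
      by (auto intro!: derivative_eq_intros 1 2 simp: algebra_simps)
  qed
  then obtain c where "\<forall>x\<in>{0..t}. f x * exp (- H x) = c"
    using has_field_derivative_zero_constant[of "{0..t}" "\<lambda>x. f x * exp (- H x)"] by auto
  then have "f t * exp (- H t) = f 0 * exp (- H 0)"
    using t0 by auto
  then have "f t = exp (H t - H 0) * f 0"
    by (simp add: exp_diff exp_minus field_simps)
  then show ?thesis
    using exp_gt_zero by blast
qed

section \<open>Reduction of the system to a quadrature\<close>

text \<open>The quadrature uses only the differential equations of \<open>Z\<close> and \<open>F\<close>, so it is carried out for both
  shapes of \<open>Z\<close>, power and logarithm, at once. The initial data are \<open>u1 = p\<close> and \<open>u2 = u3 = q\<close>.\<close>

locale blowup_profile =
  fixes a1 a p q :: real and Z F :: "real \<Rightarrow> real"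
  assumes a1: "0 < a1" and p: "0 < p" and q: "0 < q"
    and Z_deriv: "\<And>y. 0 < y \<Longrightarrow> (Z has_real_derivative (1 - (2 * a / a1 - 1) * Z y) / y) (at y)"
    and Z_init: "Z q = q / p"
    and F_deriv: "\<And>y. 0 < y \<Longrightarrow> (F has_real_derivative - (Z y / (a1 * y ^ 3))) (at y)"
    and F_lim: "(F \<longlongrightarrow> 0) at_top"
begin

definition \<beta> :: real where "\<beta> = 2 * a / a1 - 1"

lemma Z_weighted_deriv:
  assumes "0 < y"
  shows "((\<lambda>y. Z y * y powr \<beta>) has_real_derivative y powr (\<beta> - 1)) (at y)"
proof -
  have "((\<lambda>y. Z y * y powr \<beta>) has_real_derivative
      ((1 - \<beta> * Z y) / y) * y powr \<beta> + (\<beta> * y powr (\<beta> - 1)) * Z y) (at y)"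
    using DERIV_mult[OF Z_deriv[OF assms] has_real_derivative_powr[OF assms, of \<beta>]]
    unfolding \<beta>_def .
  moreover have "y powr \<beta> = y powr (\<beta> - 1) * y"
    using assms by (simp add: powr_diff)
  ultimately show ?thesis
    using assms by (simp add: algebra_simps diff_divide_distrib)
qed

text \<open>By the previous lemma the weight \<open>y powr \<beta>\<close> turns \<open>Z\<close> into an increasing function, which is positive at \<open>q\<close>.\<close>

lemma Z_pos:
  assumes "q \<le> y"
  shows "0 < Z y"
proof -
  have "Z q * q powr \<beta> \<le> Z y * y powr \<beta>"
  proof (rule DERIV_nonneg_imp_nondecreasing[OF assms])
    fix x assume "q \<le> x"
    then show "\<exists>d. ((\<lambda>y. Z y * y powr \<beta>) has_real_derivative d) (at x) \<and> 0 \<le> d"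
      using Z_weighted_deriv[of x] q by (auto intro!: exI[of _ "x powr (\<beta> - 1)"])
  qed
  moreover have "0 < Z q * q powr \<beta>"
    using Z_init p q by simp
  ultimately have "0 < Z y * y powr \<beta>"
    by linarith
  then show ?thesis
    using assms q by (simp add: zero_less_mult_iff)
qed

text \<open>A margin to the left of \<open>q\<close> makes \<open>q\<close> an interior point of the domain on which \<open>F\<close> is inverted, so
  that the inverse is differentiable at the initial time too.\<close>

lemma Z_pos_left_of_q: "\<exists>q0. 0 < q0 \<and> q0 < q \<and> (\<forall>y>q0. 0 < Z y)"
proof -
  have "isCont Z q"
    using Z_deriv[OF q] by (rule DERIV_isCont)
  then have "\<forall>\<^sub>F y in at q. 0 < Z y"
    using Z_pos[of q] unfolding isCont_def by (intro order_tendstoD) auto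
  then obtain d where d: "d > 0" "\<And>y. y \<noteq> q \<Longrightarrow> dist y q < d \<Longrightarrow> 0 < Z y"
    unfolding eventually_at by auto
  define q0 where "q0 = max (q / 2) (q - d)"
  have "0 < Z y" if "q0 < y" for y
    using d(2)[of y] Z_pos[of y] that by (cases "y < q") (auto simp: q0_def dist_real_def)
  moreover have "0 < q0" "q0 < q"
    using q d(1) by (auto simp: q0_def)
  ultimately show ?thesis
    by blast
qed

lemma F_strict_decreasing:
  assumes "0 < x" "x < y" "\<And>s. x \<le> s \<Longrightarrow> 0 < Z s"
  shows "F y < F x"
proof (rule DERIV_neg_imp_decreasing[OF assms(2)])
  fix s assume "x \<le> s"
  then have "0 < s" "0 < Z s"
    using assms by auto
  then have "0 < Z s / (a1 * s ^ 3)"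
    using a1 by simp
  then show "\<exists>d. (F has_real_derivative d) (at s) \<and> d < 0"
    using F_deriv[OF \<open>0 < s\<close>] by force
qed

lemma F_decreasing_above_q: "q \<le> x \<Longrightarrow> x < y \<Longrightarrow> F y < F x"
  using F_strict_decreasing[of x y] Z_pos q by auto

lemma F_inj_above_q: "q \<le> x \<Longrightarrow> q \<le> y \<Longrightarrow> F x = F y \<Longrightarrow> x = y"
  using F_decreasing_above_q[of x y] F_decreasing_above_q[of y x] by (cases x y rule: linorder_cases) auto

lemma F_pos:
  assumes "q \<le> y"
  shows "0 < F y"
proof -
  have "\<forall>\<^sub>F s in at_top. F s \<le> F (y + 1)"
    using eventually_gt_at_top[of "y + 1"]
    by eventually_elim (use F_decreasing_above_q[of "y + 1"] assms in \<open>auto intro: less_imp_le\<close>)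
  then have "0 \<le> F (y + 1)"
    using tendsto_upperbound[OF F_lim] by simp
  then show ?thesis
    using F_decreasing_above_q[of y "y + 1"] assms by simp
qed

lemma F_surj:
  assumes "0 < s" "s \<le> F q"
  shows "\<exists>y\<ge>q. F y = s"
proof -
  have "\<forall>\<^sub>F y in at_top. F y < s \<and> q \<le> y"
    using order_tendstoD(2)[OF F_lim assms(1)] eventually_ge_at_top[of q] by eventually_elim auto
  then obtain Y where Y: "F Y < s" "q \<le> Y"
    using eventually_happens'[OF trivial_limit_at_top_linorder] by blast
  have "continuous_on {q..Y} F"
    using q by (auto intro!: continuous_at_imp_continuous_on DERIV_isCont[OF F_deriv])
  then show ?thesis
    using IVT2'[of F Y s q] Y assms by auto
qed

text \<open>Four quantities obey linear equations along a solution: \<open>u2 - u3\<close> and \<open>u2 / u1 - Z(u2)\<close>, which start at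
  zero and so vanish, \<open>u1\<close>, which therefore stays positive, and \<open>F(u2) + t\<close>, whose derivative is zero.
  Monotonicity of \<open>u2\<close> keeps the solution in the range \<open>y \<ge> q\<close>, where \<open>Z\<close> is positive and \<open>F\<close> injective.\<close>

lemma solution_on_profile:
  assumes sol: "solves_system a1 a a u1 u2 u3 T"
    and init: "u1 0 = p" "u2 0 = q" "u3 0 = q"
    and t: "t \<in> existence_interval T"
  shows "u3 t = u2 t" and "q \<le> u2 t" and "u1 t = u2 t / Z (u2 t)" and "F (u2 t) = F q - t"
proof -
  let ?I = "existence_interval T"
  have T: "0 < T"
    using sol by (simp add: solves_system_def)
  have d1: "(u1 has_real_derivative (u1 t)\<^sup>2 * (a * u2 t + a * u3 t - a1 * u1 t)) (at t within ?I)"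
    and d2: "(u2 has_real_derivative (u2 t)\<^sup>2 * (a * u3 t + a1 * u1 t - a * u2 t)) (at t within ?I)"
    and d3: "(u3 has_real_derivative (u3 t)\<^sup>2 * (a1 * u1 t + a * u2 t - a * u3 t)) (at t within ?I)"
    if "t \<in> ?I" for t
    using sol that by (auto simp: solves_system_def)
  have c: "continuous_on ?I u1" "continuous_on ?I u2" "continuous_on ?I u3"
    using d1 d2 d3 by (auto intro!: DERIV_continuous_on)
  have eq: "u3 t = u2 t" if "t \<in> ?I" for t
  proof -
    \<comment> \<open>the difference of the last two right-hand sides, divided by \<open>u2 - u3\<close>\<close>
    let ?h = "\<lambda>t. (u2 t + u3 t) * a1 * u1 t - a * ((u2 t)\<^sup>2 + (u3 t)\<^sup>2)"
    have "\<exists>k>0. u2 t - u3 t = k * (u2 0 - u3 0)"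
    proof (rule linear_ode_positive_multiple[where h = ?h, OF _ _ that])
      fix t assume t: "t \<in> ?I"
      show "((\<lambda>t. u2 t - u3 t) has_real_derivative ?h t * (u2 t - u3 t)) (at t within ?I)"
        by (auto intro!: derivative_eq_intros d2[OF t] d3[OF t] simp: algebra_simps power2_eq_square)
    qed (intro continuous_intros c)
    then show ?thesis
      using init by auto
  qed
  have pos1: "0 < u1 t" if "t \<in> ?I" for t
  proof -
    have "\<exists>k>0. u1 t = k * u1 0"
    proof (rule linear_ode_positive_multiple[where h = "\<lambda>t. u1 t * (a * u2 t + a * u3 t - a1 * u1 t)", OF _ _ that])
      fix t assume t: "t \<in> ?I"
      show "(u1 has_real_derivative u1 t * (a * u2 t + a * u3 t - a1 * u1 t) * u1 t) (at t within ?I)"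
        using d1[OF t] by (simp add: power2_eq_square mult_ac)
    qed (intro continuous_intros c)
    then show ?thesis
      using init p by auto
  qed
  have d2': "(u2 has_real_derivative a1 * u1 t * (u2 t)\<^sup>2) (at t within ?I)" if "t \<in> ?I" for t
    using d2[OF that] eq[OF that] by (simp add: mult_ac)
  have ge: "q \<le> u2 t" if t: "t \<in> ?I" for t
  proof -
    have sub: "{0..t} \<subseteq> ?I" and t0: "0 \<le> t"
      using t Icc_subset_existence_interval[OF t] by (auto simp: existence_interval_def)
    have "u2 0 \<le> u2 t"
    proof (rule DERIV_nonneg_imp_increasing_open[OF t0])
      show "continuous_on {0..t} u2"
        using c(2) sub by (rule continuous_on_subset)
      fix x assume x: "0 < x" "x < t"
      have "(u2 has_real_derivative a1 * u1 x * (u2 x)\<^sup>2) (at x within {0..t})"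
        using d2'[of x] sub x by (meson atLeastAtMost_iff has_field_derivative_subset less_imp_le subsetD)
      moreover have "at x within {0..t} = at x"
        using x by (simp add: at_within_Icc_at)
      ultimately have "(u2 has_real_derivative a1 * u1 x * (u2 x)\<^sup>2) (at x)"
        by simp
      moreover have "0 \<le> a1 * u1 x * (u2 x)\<^sup>2"
        using pos1[of x] subsetD[OF sub, of x] x a1 by simp
      ultimately show "\<exists>y. (u2 has_real_derivative y) (at x) \<and> 0 \<le> y"
        by blast
    qed
    then show ?thesis
      using init by simp
  qed
  have pos2: "0 < u2 t" if "t \<in> ?I" for t
    using ge[OF that] q by simp
  have d1': "(u1 has_real_derivative (u1 t)\<^sup>2 * (2 * a * u2 t - a1 * u1 t)) (at t within ?I)" if "t \<in> ?I" for t
    using d1[OF that] eq[OF that] by (simp add: algebra_simps)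
  let ?w = "\<lambda>t. u2 t / u1 t - Z (u2 t)"
  have ratio: "u2 t / u1 t = Z (u2 t)" if t: "t \<in> ?I" for t
  proof -
    have "\<exists>k>0. ?w t = k * ?w 0"
    proof (rule linear_ode_positive_multiple[where h = "\<lambda>t. - (2 * a - a1) * u1 t * u2 t", OF _ _ t])
      fix t assume t: "t \<in> ?I"
      have x: "0 < u1 t" and y: "0 < u2 t"
        using pos1 pos2 t by auto
      have dz: "((\<lambda>t. Z (u2 t)) has_real_derivative
          (1 - (2 * a / a1 - 1) * Z (u2 t)) / u2 t * (a1 * u1 t * (u2 t)\<^sup>2)) (at t within ?I)"
        by (rule DERIV_chain2[OF Z_deriv[OF y] d2'[OF t]])
      show "(?w has_real_derivative - (2 * a - a1) * u1 t * u2 t * ?w t) (at t within ?I)"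
        apply (rule DERIV_cong)
         apply (rule DERIV_diff[OF DERIV_divide[OF d2'[OF t] d1'[OF t]] dz])
        using x y a1 by (auto simp: field_simps power2_eq_square)
    qed (intro continuous_intros c)
    then show ?thesis
      using init Z_init by auto
  qed
  have "F (u2 t) + t = F (u2 0) + 0"
  proof (rule zero_derivative_existence_interval[OF _ T t])
    fix t assume t: "t \<in> ?I"
    have x: "0 < u1 t" and y: "0 < u2 t"
      using pos1 pos2 t by auto
    have "((\<lambda>t. F (u2 t)) has_real_derivative
        - (Z (u2 t) / (a1 * u2 t ^ 3)) * (a1 * u1 t * (u2 t)\<^sup>2)) (at t within ?I)"
      by (rule DERIV_chain2[OF F_deriv[OF y] d2'[OF t]])
    moreover have "- (Z (u2 t) / (a1 * u2 t ^ 3)) * (a1 * u1 t * (u2 t)\<^sup>2) = -1"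
      using x y a1 unfolding ratio[OF t, symmetric] by (simp add: field_simps eval_nat_numeral)
    ultimately have "((\<lambda>t. F (u2 t)) has_real_derivative -1) (at t within ?I)"
      by simp
    from DERIV_add[OF this DERIV_ident]
    show "((\<lambda>t. F (u2 t) + t) has_real_derivative 0) (at t within ?I)"
      by simp
  qed
  then show "F (u2 t) = F q - t"
    using init by simp
  show "u3 t = u2 t" "q \<le> u2 t"
    using eq ge t by auto
  show "u1 t = u2 t / Z (u2 t)"
    using ratio[OF t] pos1[OF t] pos2[OF t] Z_pos[OF ge[OF t]] by (auto simp: field_simps)
qed

text \<open>The second component is obtained by solving \<open>F(y(t)) = F(q) - t\<close> for \<open>y(t)\<close>; the first is then
  \<open>y(t) / Z(y(t))\<close>.\<close>

lemma profile_solution: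
  obtains x y where "solves_system a1 a a x y y (ereal (F q))" "x 0 = p" "y 0 = q"
proof -
  obtain q0 where q0: "0 < q0" "q0 < q" "\<And>y. q0 < y \<Longrightarrow> 0 < Z y"
    using Z_pos_left_of_q by blast
  have inj: "inj_on F {q0<..}"
  proof (rule linorder_inj_onI)
    fix x y assume "x < y" "x \<in> {q0<..}"
    then show "F x \<noteq> F y"
      using F_strict_decreasing[of x y] q0 by simp
  qed auto
  define g where "g = inv_into {q0<..} F"
  have g: "g (F y) = y" if "q0 < y" for y
    using inv_into_f_f[OF inj] that by (simp add: g_def)
  have dg: "(g has_real_derivative inverse (- (Z y / (a1 * y ^ 3)))) (at (F y))" if y: "q0 < y" for y
  proof (rule has_field_derivative_inverse_strong[OF F_deriv _ open_greaterThan[of q0]])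
    show "0 < y" "y \<in> {q0<..}"
      using y q0 by auto
    show "- (Z y / (a1 * y ^ 3)) \<noteq> 0"
      using q0(3)[OF y] q0(1) y a1 by auto
    show "continuous_on {q0<..} F"
      using q0(1) by (auto intro!: continuous_at_imp_continuous_on DERIV_isCont[OF F_deriv])
  qed (use g in auto)
  define y where "y = (\<lambda>t. g (F q - t))"
  define x where "x = (\<lambda>t. y t / Z (y t))"
  have "solves_system a1 a a x y y (ereal (F q))"
    unfolding solves_system_def
  proof (intro conjI ballI)
    show "0 < ereal (F q)"
      using F_pos[of q] by simp
    fix t assume "t \<in> existence_interval (ereal (F q))"
    then have t: "0 \<le> t" "t < F q"
      by (auto simp: existence_interval_def)
    obtain s where s: "q \<le> s" "F s = F q - t"
      using F_surj[of "F q - t"] t by auto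
    have ys: "y t = s"
      using g[of s] s q0(2) by (simp add: y_def)
    have sp: "0 < s" and Zp: "0 < Z s" and sq: "q0 < s"
      using s q q0(2) Z_pos by auto
    have "(y has_real_derivative inverse (- (Z s / (a1 * s ^ 3))) * (- 1)) (at t)"
      unfolding y_def
      by (rule DERIV_chain2[where f = g])
        (use dg[OF sq] s(2) in \<open>auto intro!: derivative_eq_intros\<close>)
    then have dy: "(y has_real_derivative a1 * s ^ 3 / Z s) (at t)"
      by simp
    have "(Z has_real_derivative (1 - (2 * a / a1 - 1) * Z s) / s) (at (y t))"
      using Z_deriv[OF sp] ys by simp
    from DERIV_chain2[OF this dy]
    have dz: "((\<lambda>t. Z (y t)) has_real_derivative
        (1 - (2 * a / a1 - 1) * Z s) / s * (a1 * s ^ 3 / Z s)) (at t)" .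
    have "(x has_real_derivative (x t)\<^sup>2 * (a * y t + a * y t - a1 * x t)) (at t)"
      unfolding x_def
      apply (rule DERIV_cong)
       apply (rule DERIV_divide[OF dy dz])
      using sp Zp a1 unfolding ys by (auto simp: field_simps eval_nat_numeral)
    then show "(x has_real_derivative (x t)\<^sup>2 * (a * y t + a * y t - a1 * x t))
        (at t within existence_interval (ereal (F q)))"
      by (rule has_field_derivative_at_within)
    have "a1 * s ^ 3 / Z s = (y t)\<^sup>2 * (a1 * x t)"
      unfolding x_def ys by (simp add: eval_nat_numeral)
    with dy have "(y has_real_derivative (y t)\<^sup>2 * (a1 * x t)) (at t)"
      by simp
    then show "(y has_real_derivative (y t)\<^sup>2 * (a * y t + a1 * x t - a * y t))
        (at t within existence_interval (ereal (F q)))"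
      "(y has_real_derivative (y t)\<^sup>2 * (a1 * x t + a * y t - a * y t))
        (at t within existence_interval (ereal (F q)))"
      by (auto intro: has_field_derivative_at_within)
  qed
  moreover have y0: "y 0 = q"
    using g[of q] q0(2) by (simp add: y_def)
  moreover have "x 0 = p"
    using Z_init p q y0 by (simp add: x_def)
  ultimately show ?thesis
    using that by blast
qed

text \<open>At time \<open>F(q)\<close> the remaining time \<open>F(u2)\<close> would be zero, but \<open>F\<close> is positive.\<close>

lemma existence_time_le:
  assumes sol: "solves_system a1 a a u1 u2 u3 T"
    and init: "u1 0 = p" "u2 0 = q" "u3 0 = q"
  shows "T \<le> ereal (F q)"
proof (rule ccontr)
  assume "\<not> ?thesis"
  then have t: "F q \<in> existence_interval T"
    using F_pos[of q] by (simp add: existence_interval_def)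
  show False
    using solution_on_profile(4)[OF assms t] F_pos[OF solution_on_profile(2)[OF assms t]] by simp
qed

lemma maximal_solution_exists:
  "\<exists>u1 u2 u3 T. maximal_solution a1 a a u1 u2 u3 T \<and> u1 0 = p \<and> u2 0 = q \<and> u3 0 = q"
proof -
  obtain x y where sol: "solves_system a1 a a x y y (ereal (F q))" and init: "x 0 = p" "y 0 = q"
    by (rule profile_solution)
  have "\<not> (ereal (F q) < T' \<and> solves_system a1 a a v1 v2 v3 T' \<and>
      (\<forall>t\<in>existence_interval (ereal (F q)). v1 t = x t \<and> v2 t = y t \<and> v3 t = y t))" for T' v1 v2 v3
  proof
    assume *: "ereal (F q) < T' \<and> solves_system a1 a a v1 v2 v3 T' \<and>
      (\<forall>t\<in>existence_interval (ereal (F q)). v1 t = x t \<and> v2 t = y t \<and> v3 t = y t)"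
    have "0 \<in> existence_interval (ereal (F q))"
      using F_pos[of q] by (simp add: existence_interval_def)
    then have "T' \<le> ereal (F q)"
      using * init by (intro existence_time_le[of v1 v2 v3]) auto
    then show False
      using * by auto
  qed
  then have "maximal_solution a1 a a x y y (ereal (F q))"
    using sol by (auto simp: maximal_solution_def)
  then show ?thesis
    using init by blast
qed

text \<open>A solution that stops before \<open>F(q)\<close> is extended by the profile solution: both have the same value of \<open>F\<close> at
  each time, and \<open>F\<close> is injective.\<close>

lemma maximal_solution_time:
  assumes max: "maximal_solution a1 a a u1 u2 u3 T"
    and init: "u1 0 = p" "u2 0 = q" "u3 0 = q"
  shows "T = ereal (F q)"
proof (rule ccontr)
  assume "T \<noteq> ereal (F q)"
  have sol: "solves_system a1 a a u1 u2 u3 T"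
    using max by (simp add: maximal_solution_def)
  have T: "T < ereal (F q)"
    using existence_time_le[OF sol init] \<open>T \<noteq> ereal (F q)\<close> by simp
  obtain x y where sol': "solves_system a1 a a x y y (ereal (F q))" and init': "x 0 = p" "y 0 = q"
    by (rule profile_solution)
  have "x t = u1 t \<and> y t = u2 t \<and> y t = u3 t" if t: "t \<in> existence_interval T" for t
  proof -
    have t': "t \<in> existence_interval (ereal (F q))"
      using t T by (auto simp: existence_interval_def dest: order.strict_trans)
    note u = solution_on_profile[OF sol init t]
    note v = solution_on_profile[OF sol' init' init'(2) t']
    have "y t = u2 t"
      using F_inj_above_q[OF v(2) u(2)] u(4) v(4) by simp
    then show ?thesis
      using u v by simp
  qed
  then show False
    using max T sol' unfolding maximal_solution_def by blast
qed

lemma u2_at_top: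
  assumes sol: "solves_system a1 a a u1 u2 u3 (ereal (F q))"
    and init: "u1 0 = p" "u2 0 = q" "u3 0 = q"
  shows "filterlim u2 at_top (at_left (F q))"
  unfolding filterlim_at_top_gt[where c = q]
proof (intro allI impI)
  fix Y assume Y: "q < Y"
  have "\<forall>\<^sub>F t in at_left (F q). t \<in> {max 0 (F q - F Y)<..<F q}"
    using F_pos[of q] F_pos[of Y] Y by (intro eventually_at_leftI[of "max 0 (F q - F Y)"]) auto
  then show "\<forall>\<^sub>F t in at_left (F q). Y \<le> u2 t"
  proof eventually_elim
    case (elim t)
    then have "t \<in> existence_interval (ereal (F q))"
      by (simp add: existence_interval_def)
    note u = solution_on_profile[OF sol init this]
    have "F (u2 t) < F Y"
      using u(4) elim by simp
    then show ?case
      using F_decreasing_above_q[OF u(2), of Y] by linarith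
  qed
qed

text \<open>Substituting \<open>y = u2(t)\<close>, which tends to infinity, turns \<open>F(y)\<close> into the remaining time \<open>F(q) - t\<close>.\<close>

lemma asymp_left_from_profile:
  assumes sol: "solves_system a1 a a u1 u2 u3 (ereal (F q))"
    and init: "u1 0 = p" "u2 0 = q" "u3 0 = q"
    and C: "0 < C"
    and f: "\<And>t. t \<in> existence_interval (ereal (F q)) \<Longrightarrow> f t = \<phi> (u2 t)"
    and lim: "((\<lambda>y. \<phi> y / \<psi> (F y)) \<longlongrightarrow> C) at_top"
  shows "asymp_left_const (F q) f (\<lambda>t. \<psi> (F q - t))"
proof -
  have "((\<lambda>y. \<bar>\<phi> y / \<psi> (F y) / C\<bar>) \<longlongrightarrow> \<bar>C / C\<bar>) at_top"
    using C by (intro tendsto_intros lim) auto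
  then have "((\<lambda>y. \<bar>\<phi> y / \<psi> (F y) / C\<bar>) \<longlongrightarrow> 1) at_top"
    using C by simp
  from filterlim_compose[OF this u2_at_top[OF sol init]]
  have "((\<lambda>t. \<bar>\<phi> (u2 t) / \<psi> (F (u2 t)) / C\<bar>) \<longlongrightarrow> 1) (at_left (F q))" .
  moreover have "\<forall>\<^sub>F t in at_left (F q). t \<in> {0<..<F q}"
    using F_pos[of q] by (intro eventually_at_leftI[of 0]) auto
  then have "\<forall>\<^sub>F t in at_left (F q). \<bar>\<phi> (u2 t) / \<psi> (F (u2 t)) / C\<bar> = \<bar>f t / (C * \<psi> (F q - t))\<bar>"
  proof eventually_elim
    case (elim t)
    then have "t \<in> existence_interval (ereal (F q))"
      by (simp add: existence_interval_def)
    then show ?case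
      using solution_on_profile(4)[OF sol init] f by (simp add: mult.commute)
  qed
  ultimately have "((\<lambda>t. \<bar>f t / (C * \<psi> (F q - t))\<bar>) \<longlongrightarrow> 1) (at_left (F q))"
    by (rule Lim_transform_eventually)
  then show ?thesis
    using C unfolding asymp_left_const_def asymp_left_def by blast
qed

lemma blowup_with_rates:
  assumes C: "0 < C\<^sub>1" "0 < C\<^sub>2"
    and lim1: "((\<lambda>y. y / Z y / \<psi>\<^sub>1 (F y)) \<longlongrightarrow> C\<^sub>1) at_top"
    and lim2: "((\<lambda>y. y / \<psi>\<^sub>2 (F y)) \<longlongrightarrow> C\<^sub>2) at_top"
  shows "(\<exists>u1 u2 u3 T. maximal_solution a1 a a u1 u2 u3 T \<and> u1 0 = p \<and> u2 0 = q \<and> u3 0 = q) \<and>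
    (\<forall>u1 u2 u3 T. maximal_solution a1 a a u1 u2 u3 T \<and> u1 0 = p \<and> u2 0 = q \<and> u3 0 = q \<longrightarrow>
      (\<exists>tmax. T = ereal tmax \<and> blows_up_at u1 u2 u3 tmax \<and>
        (\<forall>t\<in>existence_interval T. u2 t = u3 t) \<and>
        asymp_left_const tmax u1 (\<lambda>t. \<psi>\<^sub>1 (tmax - t)) \<and>
        asymp_left_const tmax u2 (\<lambda>t. \<psi>\<^sub>2 (tmax - t)) \<and>
        asymp_left_const tmax u3 (\<lambda>t. \<psi>\<^sub>2 (tmax - t))))"
proof (rule conjI[OF maximal_solution_exists], intro allI impI)
  fix u1 u2 u3 T
  assume *: "maximal_solution a1 a a u1 u2 u3 T \<and> u1 0 = p \<and> u2 0 = q \<and> u3 0 = q"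
  then have T: "T = ereal (F q)"
    using maximal_solution_time by blast
  have sol: "solves_system a1 a a u1 u2 u3 (ereal (F q))"
    and init: "u1 0 = p" "u2 0 = q" "u3 0 = q"
    using * unfolding T by (auto simp: maximal_solution_def)
  have "u2 t \<le> norm (u1 t, u2 t, u3 t)" for t
    using norm_fst_le[of "u2 t" "u3 t"] norm_snd_le[of "(u2 t, u3 t)" "u1 t"] by (simp add: abs_le_iff)
  then have blow: "blows_up_at u1 u2 u3 (F q)"
    unfolding blows_up_at_def by (intro filterlim_at_top_mono[OF u2_at_top[OF sol init]]) auto
  note u = solution_on_profile[OF sol init]
  show "\<exists>tmax. T = ereal tmax \<and> blows_up_at u1 u2 u3 tmax \<and>
        (\<forall>t\<in>existence_interval T. u2 t = u3 t) \<and>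
        asymp_left_const tmax u1 (\<lambda>t. \<psi>\<^sub>1 (tmax - t)) \<and>
        asymp_left_const tmax u2 (\<lambda>t. \<psi>\<^sub>2 (tmax - t)) \<and>
        asymp_left_const tmax u3 (\<lambda>t. \<psi>\<^sub>2 (tmax - t))"
  proof (intro exI[of _ "F q"] conjI)
    show "\<forall>t\<in>existence_interval T. u2 t = u3 t"
      using u(1) unfolding T by simp
    show "asymp_left_const (F q) u1 (\<lambda>t. \<psi>\<^sub>1 (F q - t))"
      by (rule asymp_left_from_profile[OF sol init C(1) _ lim1]) (rule u(3))
    show "asymp_left_const (F q) u2 (\<lambda>t. \<psi>\<^sub>2 (F q - t))"
      by (rule asymp_left_from_profile[OF sol init C(2) _ lim2]) (rule refl)
    show "asymp_left_const (F q) u3 (\<lambda>t. \<psi>\<^sub>2 (F q - t))"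
      by (rule asymp_left_from_profile[OF sol init C(2) _ lim2]) (rule u(1))
  qed (fact T blow)+
qed

end

section \<open>Explicit profiles\<close>

text \<open>The constant \<open>c\<close> is fixed by \<open>Z(q) = q / p\<close>, and the antiderivative \<open>F\<close> by its limit zero at
  infinity, which uses \<open>\<beta> + 2 > 0\<close>.\<close>

lemma power_blowup_profile:
  fixes a1 a p q :: real
  defines "\<beta> \<equiv> 2 * a / a1 - 1"
  defines "c \<equiv> (q / p - 1 / \<beta>) * q powr \<beta>"
  assumes pos: "0 < a1" "0 < a" "0 < p" "0 < q" and \<beta>: "\<beta> \<noteq> 0"
  shows "blowup_profile a1 a p q (\<lambda>y. 1 / \<beta> + c * y powr (- \<beta>))
    (\<lambda>y. (1 / (2 * \<beta>) * y powr (- 2) + c / (\<beta> + 2) * y powr (- \<beta> - 2)) / a1)"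
proof -
  have \<beta>2: "0 < \<beta> + 2"
    using divide_pos_pos[OF pos(2,1)] unfolding \<beta>_def by simp
  show ?thesis
  proof
    fix y :: real assume y: "0 < y"
    have e: "y powr (- \<beta> - 1) = y powr (- \<beta>) / y"
        "y powr (- \<beta> - 2 - 1) = y powr (- \<beta>) / y ^ 3" "y powr (- 2 - 1) = 1 / y ^ 3"
      using y by (simp_all add: powr_diff powr_minus power2_eq_square power3_eq_cube divide_inverse)
    have "((\<lambda>y. 1 / \<beta> + c * y powr (- \<beta>)) has_real_derivative c * (- \<beta> * y powr (- \<beta> - 1))) (at y)"
      using y by (auto intro!: derivative_eq_intros)
    moreover have "c * (- \<beta> * y powr (- \<beta> - 1)) = (1 - \<beta> * (1 / \<beta> + c * y powr (- \<beta>))) / y"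
      unfolding e(1) using \<beta> y by (simp add: algebra_simps)
    ultimately show "((\<lambda>y. 1 / \<beta> + c * y powr (- \<beta>)) has_real_derivative
        (1 - (2 * a / a1 - 1) * (1 / \<beta> + c * y powr (- \<beta>))) / y) (at y)"
      unfolding \<beta>_def[symmetric] by simp
    have "((\<lambda>y. (1 / (2 * \<beta>) * y powr (- 2) + c / (\<beta> + 2) * y powr (- \<beta> - 2)) / a1) has_real_derivative
       (1 / (2 * \<beta>) * (- 2 * y powr (- 2 - 1)) + c / (\<beta> + 2) * ((- \<beta> - 2) * y powr (- \<beta> - 2 - 1))) / a1) (at y)"
      by (intro DERIV_cdivide DERIV_add DERIV_cmult has_real_derivative_powr y)
    moreover have "(1 / (2 * \<beta>) * (- 2 * y powr (- 2 - 1)) + c / (\<beta> + 2) * ((- \<beta> - 2) * y powr (- \<beta> - 2 - 1))) / a1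
        = - ((1 / \<beta> + c * y powr (- \<beta>)) / (a1 * y ^ 3))"
    proof -
      have "c / (\<beta> + 2) * (- \<beta> - 2) = - c"
        using \<beta>2 by (simp add: field_simps)
      then have 1: "c / (\<beta> + 2) * ((- \<beta> - 2) * w) = - c * w" for w
        by (metis mult.assoc)
      have 2: "1 / (2 * \<beta>) * (- 2 * w) = - w / \<beta>" for w
        by simp
      show ?thesis
        unfolding e 1 2 using \<beta> y pos(1) by (simp add: divide_simps)
    qed
    ultimately show "((\<lambda>y. (1 / (2 * \<beta>) * y powr (- 2) + c / (\<beta> + 2) * y powr (- \<beta> - 2)) / a1) has_real_derivative
        - ((1 / \<beta> + c * y powr (- \<beta>)) / (a1 * y ^ 3))) (at y)"
      by simp
  next
    show "((\<lambda>y. (1 / (2 * \<beta>) * y powr (- 2) + c / (\<beta> + 2) * y powr (- \<beta> - 2)) / a1) \<longlongrightarrow> 0) at_top"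
    proof -
      have "((\<lambda>y::real. y powr (- 2)) \<longlongrightarrow> 0) at_top" "((\<lambda>y::real. y powr (- \<beta> - 2)) \<longlongrightarrow> 0) at_top"
        using \<beta>2 by (auto intro!: tendsto_neg_powr filterlim_ident)
      then have "((\<lambda>y. (1 / (2 * \<beta>) * y powr (- 2) + c / (\<beta> + 2) * y powr (- \<beta> - 2)) / a1) \<longlongrightarrow>
          (1 / (2 * \<beta>) * 0 + c / (\<beta> + 2) * 0) / a1) at_top"
        using pos(1) by (intro tendsto_divide tendsto_add tendsto_mult_left tendsto_const) auto
      then show ?thesis
        by simp
    qed
    show "1 / \<beta> + c * q powr (- \<beta>) = q / p"
      using pos by (simp add: c_def powr_minus mult.assoc)
  qed (use pos in auto)
qed

lemma log_blowup_profile: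
  fixes a1 a p q :: real
  defines "c \<equiv> q / p - ln q"
  assumes pos: "0 < a1" "0 < a" "0 < p" "0 < q" and critical: "2 * a = a1"
  shows "blowup_profile a1 a p q (\<lambda>y. ln y + c) (\<lambda>y. (ln y / 2 + 1 / 4 + c / 2) / (a1 * y\<^sup>2))"
proof
  fix y :: real assume y: "0 < y"
  show "((\<lambda>y. ln y + c) has_real_derivative (1 - (2 * a / a1 - 1) * (ln y + c)) / y) (at y)"
    using y pos critical by (auto intro!: derivative_eq_intros)
  show "((\<lambda>y. (ln y / 2 + 1 / 4 + c / 2) / (a1 * y\<^sup>2)) has_real_derivative
      - ((ln y + c) / (a1 * y ^ 3))) (at y)"
    using y pos by (auto intro!: derivative_eq_intros simp: field_simps eval_nat_numeral)
next
  show "((\<lambda>y. (ln y / 2 + 1 / 4 + c / 2) / (a1 * y\<^sup>2)) \<longlongrightarrow> 0) at_top"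
    using pos(1) by real_asymp
qed (use pos in \<open>auto simp: c_def\<close>)

section \<open>Growth rates\<close>

text \<open>If \<open>F(y)\<close> behaves like \<open>K / y\<^sup>m\<close>, then \<open>y\<^sup>k\<close> behaves like a constant times \<open>F(y)\<close> to the power
  \<open>- k / m\<close>.\<close>

lemma rate_from_power_limit:
  fixes F :: "real \<Rightarrow> real"
  assumes "((\<lambda>y. F y * y powr m) \<longlongrightarrow> K) at_top" and "0 < K" and "0 < m"
  shows "((\<lambda>y. y powr k / F y powr (- (k / m))) \<longlongrightarrow> K powr (k / m)) at_top"
proof -
  have "((\<lambda>y. (F y * y powr m) powr (k / m)) \<longlongrightarrow> K powr (k / m)) at_top"
    using assms by (intro tendsto_intros) auto
  moreover have "\<forall>\<^sub>F y in at_top. (F y * y powr m) powr (k / m) = y powr k / F y powr (- (k / m))"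
    using order_tendstoD(1)[OF assms(1,2)] eventually_gt_at_top[of 0]
  proof eventually_elim
    case (elim y)
    then have "0 < F y"
      by (simp add: zero_less_mult_iff)
    moreover have "(y powr m) powr (k / m) = y powr k"
      using assms(3) by (simp add: powr_powr)
    ultimately show ?case
      by (simp add: powr_mult powr_minus_divide mult.commute)
  qed
  ultimately show ?thesis
    by (rule Lim_transform_eventually)
qed

text \<open>For positive \<open>\<beta>\<close> the power \<open>y powr (- \<beta>)\<close> dies out, so \<open>F(y)\<close> behaves like \<open>1 / (2 \<beta> a1 y\<^sup>2)\<close> and
  \<open>Z\<close> tends to \<open>1 / \<beta>\<close>.\<close>

lemma subcritical_rates:
  fixes \<beta> c a1 :: real
  assumes "0 < \<beta>" "0 < a1"
  defines "Z \<equiv> \<lambda>y. 1 / \<beta> + c * y powr (- \<beta>)"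
  defines "F \<equiv> \<lambda>y. (1 / (2 * \<beta>) * y powr (- 2) + c / (\<beta> + 2) * y powr (- \<beta> - 2)) / a1"
  defines "C \<equiv> (1 / (2 * \<beta> * a1)) powr (1 / 2)"
  shows "((\<lambda>y. y / F y powr (- 1 / 2)) \<longlongrightarrow> C) at_top"
    and "((\<lambda>y. y / Z y / F y powr (- 1 / 2)) \<longlongrightarrow> \<beta> * C) at_top"
proof -
  have decay: "((\<lambda>y::real. y powr (- \<beta>)) \<longlongrightarrow> 0) at_top"
    using assms(1) by (auto intro!: tendsto_neg_powr filterlim_ident)
  have "((\<lambda>y. (1 / (2 * \<beta>) + c / (\<beta> + 2) * y powr (- \<beta>)) / a1) \<longlongrightarrow>
      (1 / (2 * \<beta>) + c / (\<beta> + 2) * 0) / a1) at_top"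
    using assms(2) by (intro tendsto_intros decay) auto
  then have "((\<lambda>y. (1 / (2 * \<beta>) + c / (\<beta> + 2) * y powr (- \<beta>)) / a1) \<longlongrightarrow> 1 / (2 * \<beta> * a1)) at_top"
    by simp
  moreover have "\<forall>\<^sub>F y in at_top. (1 / (2 * \<beta>) + c / (\<beta> + 2) * y powr (- \<beta>)) / a1 = F y * y powr 2"
    using eventually_gt_at_top[of 0]
  proof eventually_elim
    case (elim y)
    have "y powr (- 2) * y powr 2 = 1" "y powr (- \<beta> - 2) * y powr 2 = y powr (- \<beta>)"
      using elim by (simp_all flip: powr_add del: powr_numeral)
    then show ?case
      by (simp add: F_def distrib_right mult.assoc del: powr_numeral)
  qed
  ultimately have "((\<lambda>y. F y * y powr 2) \<longlongrightarrow> 1 / (2 * \<beta> * a1)) at_top"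
    by (rule Lim_transform_eventually)
  from rate_from_power_limit[OF this, of 1]
  have "((\<lambda>y. y powr 1 / F y powr (- 1 / 2)) \<longlongrightarrow> C) at_top"
    using assms(1,2) by (simp add: C_def)
  moreover have "\<forall>\<^sub>F y in at_top. y powr 1 / F y powr (- 1 / 2) = y / F y powr (- 1 / 2)"
    using eventually_gt_at_top[of 0] by eventually_elim simp
  ultimately show rate: "((\<lambda>y. y / F y powr (- 1 / 2)) \<longlongrightarrow> C) at_top"
    by (rule Lim_transform_eventually)
  have "(Z \<longlongrightarrow> 1 / \<beta>) at_top"
    unfolding Z_def using tendsto_add[OF tendsto_const tendsto_mult_left[OF decay]] by fastforce
  from tendsto_divide[OF rate this]
  have "((\<lambda>y. y / F y powr (- 1 / 2) / Z y) \<longlongrightarrow> C / (1 / \<beta>)) at_top"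
    using assms(1) by simp
  then show "((\<lambda>y. y / Z y / F y powr (- 1 / 2)) \<longlongrightarrow> \<beta> * C) at_top"
    by (simp add: mult.commute)
qed

text \<open>For negative \<open>\<beta>\<close> the power dominates instead: \<open>F(y)\<close> behaves like \<open>K / y\<^sup>m\<close> with \<open>m = \<beta> + 2\<close>, and
  \<open>y / Z(y)\<close> like \<open>y powr (1 + \<beta>) / c\<close>. Since \<open>1 / \<beta>\<close> is negative here, positivity of \<open>c\<close> is what makes \<open>Z\<close>
  positive at infinity.\<close>

lemma supercritical_rates:
  fixes \<beta> c a1 :: real
  assumes "\<beta> < 0" "- 1 < \<beta>" "0 < a1" "0 < c"
  defines "Z \<equiv> \<lambda>y. 1 / \<beta> + c * y powr (- \<beta>)"
  defines "F \<equiv> \<lambda>y. (1 / (2 * \<beta>) * y powr (- 2) + c / (\<beta> + 2) * y powr (- \<beta> - 2)) / a1"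
  defines "K \<equiv> c / ((\<beta> + 2) * a1)"
  shows "((\<lambda>y. y / F y powr (- (1 / (\<beta> + 2)))) \<longlongrightarrow> K powr (1 / (\<beta> + 2))) at_top"
    and "((\<lambda>y. y / Z y / F y powr (- ((1 + \<beta>) / (\<beta> + 2)))) \<longlongrightarrow>
      K powr ((1 + \<beta>) / (\<beta> + 2)) / c) at_top"
proof -
  have decay: "((\<lambda>y::real. y powr \<beta>) \<longlongrightarrow> 0) at_top"
    using assms(1) by (auto intro!: tendsto_neg_powr filterlim_ident)
  have "((\<lambda>y. (1 / (2 * \<beta>) * y powr \<beta> + c / (\<beta> + 2)) / a1) \<longlongrightarrow>
      (1 / (2 * \<beta>) * 0 + c / (\<beta> + 2)) / a1) at_top"
    using assms(3) by (intro tendsto_intros decay) auto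
  then have "((\<lambda>y. (1 / (2 * \<beta>) * y powr \<beta> + c / (\<beta> + 2)) / a1) \<longlongrightarrow> K) at_top"
    by (simp add: K_def)
  moreover have "\<forall>\<^sub>F y in at_top. (1 / (2 * \<beta>) * y powr \<beta> + c / (\<beta> + 2)) / a1 = F y * y powr (\<beta> + 2)"
    using eventually_gt_at_top[of 0]
  proof eventually_elim
    case (elim y)
    have "y powr (- 2) * y powr (\<beta> + 2) = y powr \<beta>" "y powr (- \<beta> - 2) * y powr (\<beta> + 2) = 1"
      using elim by (simp_all flip: powr_add)
    then show ?case
      by (simp add: F_def distrib_right mult.assoc)
  qed
  ultimately have "((\<lambda>y. F y * y powr (\<beta> + 2)) \<longlongrightarrow> K) at_top"
    by (rule Lim_transform_eventually)
  moreover have "0 < K" "0 < \<beta> + 2"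
    using assms(2-4) by (auto simp: K_def)
  ultimately have rate: "((\<lambda>y. y powr k / F y powr (- (k / (\<beta> + 2)))) \<longlongrightarrow> K powr (k / (\<beta> + 2))) at_top" for k
    by (rule rate_from_power_limit)
  have "\<forall>\<^sub>F y in at_top. y powr 1 / F y powr (- (1 / (\<beta> + 2))) = y / F y powr (- (1 / (\<beta> + 2)))"
    using eventually_gt_at_top[of 0] by eventually_elim simp
  then show "((\<lambda>y. y / F y powr (- (1 / (\<beta> + 2)))) \<longlongrightarrow> K powr (1 / (\<beta> + 2))) at_top"
    by (rule Lim_transform_eventually[OF rate[of 1]])
  have "((\<lambda>y. y powr \<beta> / \<beta> + c) \<longlongrightarrow> c) at_top"
    using tendsto_add[OF tendsto_divide_zero[OF decay] tendsto_const] by fastforce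
  from tendsto_divide[OF rate[of "1 + \<beta>"] this]
  have "((\<lambda>y. y powr (1 + \<beta>) / F y powr (- ((1 + \<beta>) / (\<beta> + 2))) / (y powr \<beta> / \<beta> + c)) \<longlongrightarrow>
      K powr ((1 + \<beta>) / (\<beta> + 2)) / c) at_top"
    using assms(4) by simp
  moreover have "\<forall>\<^sub>F y in at_top. y powr (1 + \<beta>) / F y powr (- ((1 + \<beta>) / (\<beta> + 2))) / (y powr \<beta> / \<beta> + c) =
      y / Z y / F y powr (- ((1 + \<beta>) / (\<beta> + 2)))"
    using eventually_gt_at_top[of 0]
  proof eventually_elim
    case (elim y)
    have "y powr \<beta> / \<beta> + c = y powr \<beta> * Z y"
      using elim by (simp add: Z_def distrib_left flip: powr_add)
    then show ?case
      using elim by (simp add: powr_add)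
  qed
  ultimately show "((\<lambda>y. y / Z y / F y powr (- ((1 + \<beta>) / (\<beta> + 2)))) \<longlongrightarrow>
      K powr ((1 + \<beta>) / (\<beta> + 2)) / c) at_top"
    by (rule Lim_transform_eventually)
qed

text \<open>Here \<open>F(y)\<close> behaves like \<open>ln y / (2 a1 y\<^sup>2)\<close>, hence \<open>ln (1 / F(y))\<close> like \<open>2 ln y\<close>: the product of
  \<open>1 / F(y)\<close> and \<open>ln (1 / F(y))\<close> is asymptotic to \<open>4 a1 y\<^sup>2\<close>, and their quotient to \<open>a1 (y / ln y)\<^sup>2\<close>.\<close>

lemma critical_rates:
  fixes a1 c :: real
  assumes "0 < a1"
  defines "F \<equiv> \<lambda>y. (ln y / 2 + 1 / 4 + c / 2) / (a1 * y\<^sup>2)"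
  shows "((\<lambda>y. y / (ln y + c) / (inverse (F y) * inverse (ln (inverse (F y)))) powr (1 / 2)) \<longlongrightarrow>
      a1 powr (- 1 / 2)) at_top"
    and "((\<lambda>y. y / (inverse (F y) * ln (inverse (F y))) powr (1 / 2)) \<longlongrightarrow> (4 * a1) powr (- 1 / 2)) at_top"
  unfolding F_def using assms(1) by (real_asymp, simp add: powr_minus divide_inverse[of _ "inverse a1"])+

section \<open>Blow-up and its rates\<close>

theorem theorem4p16:
  fixes a1 a2 a3 a :: real
  assumes "a1 > 0" and "a2 > 0" and "a3 > 0" and "a2 = a" and "a3 = a"
  shows "\<exists>M\<ge>0. \<forall>p q :: real. p > M \<and> q > M \<longrightarrow>
    (\<exists>u1 u2 u3 T. maximal_solution a1 a2 a3 u1 u2 u3 T \<and> u1 0 = p \<and> u2 0 = q \<and> u3 0 = q) \<and>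
    (\<forall>u1 u2 u3 T. maximal_solution a1 a2 a3 u1 u2 u3 T \<and> u1 0 = p \<and> u2 0 = q \<and> u3 0 = q \<longrightarrow>
      (\<exists>tmax :: real. T = ereal tmax \<and> blows_up_at u1 u2 u3 tmax \<and>
        (2 * a > a1 \<and> a1 > a \<longrightarrow>
          asymp_left_const tmax u1 (\<lambda>t. (tmax - t) powr (- 1 / 2)) \<and>
          asymp_left_const tmax u2 (\<lambda>t. (tmax - t) powr (- 1 / 2)) \<and>
          asymp_left_const tmax u3 (\<lambda>t. (tmax - t) powr (- 1 / 2))) \<and>
        (a1 > 2 * a \<and> 2 * a > a \<longrightarrow>
          asymp_left_const tmax u1 (\<lambda>t. (tmax - t) powr (- 2 * a / (2 * a + a1))) \<and>
          (\<forall>t\<in>existence_interval T. u2 t = u3 t) \<and>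
          asymp_left_const tmax u2 (\<lambda>t. (tmax - t) powr (- a1 / (2 * a + a1))) \<and>
          asymp_left_const tmax u3 (\<lambda>t. (tmax - t) powr (- a1 / (2 * a + a1)))) \<and>
        (2 * a = a1 \<and> a1 > a \<longrightarrow>
          asymp_left_const tmax u1
            (\<lambda>t. (inverse (tmax - t) * inverse (ln (inverse (tmax - t)))) powr (1 / 2)) \<and>
          (\<forall>t\<in>existence_interval T. u2 t = u3 t) \<and>
          asymp_left_const tmax u2
            (\<lambda>t. (inverse (tmax - t) * ln (inverse (tmax - t))) powr (1 / 2)) \<and>
          asymp_left_const tmax u3
            (\<lambda>t. (inverse (tmax - t) * ln (inverse (tmax - t))) powr (1 / 2)))))"
proof (rule exI[of _ 0], rule conjI[OF order_refl], intro allI impI, goal_cases)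
  case (1 p q)
  then have pos: "0 < a1" "0 < a" "0 < p" "0 < q"
    using assms by auto
  define \<beta> where "\<beta> = 2 * a / a1 - 1"
  define c where "c = (q / p - 1 / \<beta>) * q powr \<beta>"
  note power_profile = power_blowup_profile[OF pos, folded \<beta>_def, folded c_def]
  consider (critical) "2 * a = a1" | (subcritical) "a1 < 2 * a" | (supercritical) "2 * a < a1"
    by linarith
  then show ?case
  proof cases
    case critical
    let ?\<psi>\<^sub>1 = "\<lambda>s. (inverse s * inverse (ln (inverse s))) powr (1 / 2)"
      and ?\<psi>\<^sub>2 = "\<lambda>s. (inverse s * ln (inverse s)) powr (1 / 2)"
    have "0 < a1 powr (- 1 / 2)" "0 < (4 * a1) powr (- 1 / 2)"
      using pos(1) by auto
    note result = blowup_profile.blowup_with_rates[OF log_blowup_profile[OF pos critical],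
        where \<psi>\<^sub>1 = ?\<psi>\<^sub>1 and \<psi>\<^sub>2 = ?\<psi>\<^sub>2, OF this critical_rates[OF pos(1)]]
    show ?thesis
      unfolding assms(4,5)
    proof (intro conjI allI impI, goal_cases)
      case 1
      show ?case
        by (rule conjunct1[OF result])
    next
      case (2 u1 u2 u3 T)
      with conjunct2[OF result] show ?case
        using critical by fastforce
    qed
  next
    case subcritical
    let ?\<psi> = "\<lambda>s :: real. s powr (- 1 / 2)"
    have \<beta>: "0 < \<beta>"
      using subcritical pos by (simp add: \<beta>_def field_simps)
    have "0 < \<beta> * (1 / (2 * \<beta> * a1)) powr (1 / 2)" "0 < (1 / (2 * \<beta> * a1)) powr (1 / 2)"
      using \<beta> pos(1) by auto
    note result = blowup_profile.blowup_with_rates[OF power_profile,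
        where \<psi>\<^sub>1 = ?\<psi> and \<psi>\<^sub>2 = ?\<psi>, OF less_imp_neq[OF \<beta>, symmetric] this
          subcritical_rates(2,1)[OF \<beta> pos(1)]]
    show ?thesis
      unfolding assms(4,5)
    proof (intro conjI allI impI, goal_cases)
      case 1
      show ?case
        by (rule conjunct1[OF result])
    next
      case (2 u1 u2 u3 T)
      with conjunct2[OF result] show ?case
        using subcritical by fastforce
    qed
  next
    case supercritical
    let ?\<psi>\<^sub>1 = "\<lambda>s :: real. s powr (- 2 * a / (2 * a + a1))"
      and ?\<psi>\<^sub>2 = "\<lambda>s :: real. s powr (- a1 / (2 * a + a1))"
    have \<beta>: "\<beta> < 0" "- 1 < \<beta>"
      using supercritical pos by (simp_all add: \<beta>_def field_simps)
    \<comment> \<open>\<open>c\<close> is positive because \<open>1 / \<beta>\<close> is negative\<close>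
    have "1 / \<beta> < 0" "0 < q / p"
      using \<beta>(1) pos by simp_all
    then have "0 < q / p - 1 / \<beta>"
      by linarith
    then have c: "0 < c"
      using pos by (simp add: c_def)
    have \<beta>2: "\<beta> + 2 = (2 * a + a1) / a1" "1 + \<beta> = 2 * a / a1"
      using pos by (simp_all add: \<beta>_def field_simps)
    have exponents: "- (1 / (\<beta> + 2)) = - a1 / (2 * a + a1)"
      "- ((1 + \<beta>) / (\<beta> + 2)) = - 2 * a / (2 * a + a1)"
      unfolding \<beta>2 using pos by simp_all
    let ?K = "c / ((\<beta> + 2) * a1)"
    have "0 < ?K powr ((1 + \<beta>) / (\<beta> + 2)) / c" "0 < ?K powr (1 / (\<beta> + 2))"
      using c \<beta>(2) pos(1) by auto
    note result = blowup_profile.blowup_with_rates[OF power_profile,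
        where \<psi>\<^sub>1 = ?\<psi>\<^sub>1 and \<psi>\<^sub>2 = ?\<psi>\<^sub>2, OF less_imp_neq[OF \<beta>(1)] this
          supercritical_rates(2,1)[OF \<beta> pos(1) c, unfolded exponents]]
    show ?thesis
      unfolding assms(4,5)
    proof (intro conjI allI impI, goal_cases)
      case 1
      show ?case
        by (rule conjunct1[OF result])
    next
      case (2 u1 u2 u3 T)
      with conjunct2[OF result] show ?case
        using supercritical by fastforce
    qed
  qed
qed

end
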